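(* Let $(A,A_-,A_+)$ be a strongly skeletal generalized Reedy category. Then $A$ is an Eilenberg-Zilber category.
   Context: A \emph{generalized Reedy category} is an essentially small category $A$ equipped with a degree function $\deg:\mathrm{Ob}\,A\to\mathbb{N}$ which respects isomorphisms (isomorphic objects have equal degree) and an orthogonal factorization system $(A_-,A_+)$ (left class $A_-$, right class $A_+$), such that every non-isomorphism of $A_-$ strictly lowers degree and every non-isomorphism of $A_+$ strictly raises degree. An \emph{Eilenberg-Zilber category} is a generalized Reedy category $A$ such that every pair of morphisms of $A_-$ with a common domain has an absolute pushout in $A$. A colimit is \emph{absolute} if it is preserved by every functor (equivalently, by the Yoneda embedding into presheaves of sets). If $p:a\to b$ is a morphism in a category, a morphism $i:c\to a$ is a \emph{pseudo-section} of $p$ if $pi:c\to b$ is an isomorphism. Two maps $p:a\to b$, $p':a\to b'$ are \emph{pseudo-equal} if there is an isomorphism $\phi:b\to b'$ with $\phi p=p'$. A \emph{strongly skeletal generalized Reedy category} is a generalized Reedy category $(A,A_-,A_+)$ such that (1) every morphism of $A_-$ is a split epimorphism in $A$, and (2) for every two morphisms $p:a\to b$, $p':a\to b'$ of $A_-$ with the same domain, if $p,p'$ have identical sets of pseudo-sections in $A$, then $p,p'$ are pseudo-equal. *)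

theory Defs
  imports Main
begin

section \<open>Categories\<close>

text \<open>
  No size condition is imposed: objects and arrows range over HOL types, hence form sets, so every
  such category is small.
\<close>

record ('o, 'm) cat =
  Obj :: "'o set"
  Arr :: "'m set"
  Dom :: "'m \<Rightarrow> 'o"
  Cod :: "'m \<Rightarrow> 'o"
  Ide :: "'o \<Rightarrow> 'm"
  Comp :: "'m \<Rightarrow> 'm \<Rightarrow> 'm"  (infixr "\<odot>\<index>" 70)

definition Hom :: "('o, 'm) cat \<Rightarrow> 'o \<Rightarrow> 'o \<Rightarrow> 'm set" where
  "Hom C a b = {f \<in> Arr C. Dom C f = a \<and> Cod C f = b}"

text \<open>Composition is in applicative order and is unconstrained on non-composable pairs.\<close>

locale category =
  fixes C :: "('o, 'm) cat" (structure)
  assumes Dom_in_Obj: "f \<in> Arr C \<Longrightarrow> Dom C f \<in> Obj C"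
    and Cod_in_Obj: "f \<in> Arr C \<Longrightarrow> Cod C f \<in> Obj C"
    and Ide_in_Hom: "a \<in> Obj C \<Longrightarrow> Ide C a \<in> Hom C a a"
    and Comp_in_Hom: "f \<in> Hom C a b \<Longrightarrow> g \<in> Hom C b c \<Longrightarrow> g \<odot> f \<in> Hom C a c"
    and Comp_Ide: "f \<in> Hom C a b \<Longrightarrow> f \<odot> Ide C a = f"
    and Ide_Comp: "f \<in> Hom C a b \<Longrightarrow> Ide C b \<odot> f = f"
    and Comp_assoc: "f \<in> Hom C a b \<Longrightarrow> g \<in> Hom C b c \<Longrightarrow> h \<in> Hom C c d \<Longrightarrow>
          (h \<odot> g) \<odot> f = h \<odot> (g \<odot> f)"

definition is_iso :: "('o, 'm) cat \<Rightarrow> 'm \<Rightarrow> bool" where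
  "is_iso C f \<longleftrightarrow> f \<in> Arr C \<and>
     (\<exists>g \<in> Hom C (Cod C f) (Dom C f).
        g \<odot>\<^bsub>C\<^esub> f = Ide C (Dom C f) \<and> f \<odot>\<^bsub>C\<^esub> g = Ide C (Cod C f))"

definition is_split_epi :: "('o, 'm) cat \<Rightarrow> 'm \<Rightarrow> bool" where
  "is_split_epi C p \<longleftrightarrow> p \<in> Arr C \<and>
     (\<exists>s \<in> Hom C (Cod C p) (Dom C p). p \<odot>\<^bsub>C\<^esub> s = Ide C (Cod C p))"

locale cat_functor = source: category C + target: category D
  for C :: "('o, 'm) cat" and D :: "('x, 'y) cat" +
  fixes Fo :: "'o \<Rightarrow> 'x" and Fm :: "'m \<Rightarrow> 'y"
  assumes Fo_in_Obj: "a \<in> Obj C \<Longrightarrow> Fo a \<in> Obj D"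
    and Fm_in_Hom: "f \<in> Hom C a b \<Longrightarrow> Fm f \<in> Hom D (Fo a) (Fo b)"
    and Fm_Ide: "a \<in> Obj C \<Longrightarrow> Fm (Ide C a) = Ide D (Fo a)"
    and Fm_Comp: "f \<in> Hom C a b \<Longrightarrow> g \<in> Hom C b c \<Longrightarrow> Fm (g \<odot>\<^bsub>C\<^esub> f) = Fm g \<odot>\<^bsub>D\<^esub> Fm f"


section \<open>Absolute pushouts\<close>

definition commuting_cocone :: "('o, 'm) cat \<Rightarrow> 'm \<Rightarrow> 'm \<Rightarrow> 'm \<Rightarrow> 'm \<Rightarrow> bool" where
  "commuting_cocone C p p' r r' \<longleftrightarrow>
     p \<in> Arr C \<and> p' \<in> Arr C \<and> Dom C p = Dom C p' \<and>
     r \<in> Arr C \<and> r' \<in> Arr C \<and> Dom C r = Cod C p \<and> Dom C r' = Cod C p' \<and> Cod C r = Cod C r' \<and>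
     r \<odot>\<^bsub>C\<^esub> p = r' \<odot>\<^bsub>C\<^esub> p'"

definition is_pushout :: "('o, 'm) cat \<Rightarrow> 'm \<Rightarrow> 'm \<Rightarrow> 'm \<Rightarrow> 'm \<Rightarrow> bool" where
  "is_pushout C p p' r r' \<longleftrightarrow> commuting_cocone C p p' r r' \<and>
     (\<forall>u u'. commuting_cocone C p p' u u' \<longrightarrow>
        (\<exists>!h. h \<in> Hom C (Cod C r) (Cod C u) \<and> h \<odot>\<^bsub>C\<^esub> r = u \<and> h \<odot>\<^bsub>C\<^esub> r' = u'))"

text \<open>
  HOL cannot quantify over types inside a formula, so the type of the target categories is an
  explicit argument; to be preserved by every functor is to satisfy this predicate for all types
  \<open>'x\<close> and \<open>'y\<close>, and a theorem in which these are free asserts precisely that. An existential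
  quantifier over absolute pushouts is unaffected by the choice of types: by
  \<open>absolute_pushout_cong\<close> below, the predicate does not depend on the chosen pushout of the span.
\<close>

definition is_absolute_pushout ::
  "('x, 'y) cat itself \<Rightarrow> ('o, 'm) cat \<Rightarrow> 'm \<Rightarrow> 'm \<Rightarrow> 'm \<Rightarrow> 'm \<Rightarrow> bool" where
  "is_absolute_pushout T C p p' r r' \<longleftrightarrow> is_pushout C p p' r r' \<and>
     (\<forall>(D :: ('x, 'y) cat) Fo Fm. cat_functor C D Fo Fm \<longrightarrow>
        is_pushout D (Fm p) (Fm p') (Fm r) (Fm r'))"

context category
begin

lemma Comp_simps:
  assumes "f \<in> Arr C" "g \<in> Arr C" "Dom C g = Cod C f"
  shows "g \<odot> f \<in> Arr C" "Dom C (g \<odot> f) = Dom C f" "Cod C (g \<odot> f) = Cod C g"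
  using Comp_in_Hom[of f "Dom C f" "Cod C f" g "Cod C g"] assms by (auto simp: Hom_def)

lemma assoc:
  assumes "f \<in> Arr C" "g \<in> Arr C" "h \<in> Arr C" "Dom C g = Cod C f" "Dom C h = Cod C g"
  shows "h \<odot> (g \<odot> f) = (h \<odot> g) \<odot> f"
  using Comp_assoc[of f "Dom C f" "Cod C f" g "Cod C g" h "Cod C h"] assms by (auto simp: Hom_def)

lemma pushout_comp_iso:
  assumes po: "is_pushout C p p' r r'" and h: "is_iso C h" "Dom C h = Cod C r"
  shows "is_pushout C p p' (h \<odot> r) (h \<odot> r')"
proof -
  from po have cc: "commuting_cocone C p p' r r'" by (simp add: is_pushout_def)
  note arr = cc[unfolded commuting_cocone_def]
  from h obtain g where hA: "h \<in> Arr C" and gA: "g \<in> Arr C"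
    and dc: "Dom C g = Cod C h" "Cod C g = Cod C r"
    and gh: "g \<odot> h = Ide C (Cod C r)" and hg: "h \<odot> g = Ide C (Cod C h)"
    by (auto simp: is_iso_def Hom_def)
  have id1: "\<And>f. f \<in> Arr C \<Longrightarrow> f \<odot> Ide C (Dom C f) = f"
    and id2: "\<And>f. f \<in> Arr C \<Longrightarrow> Ide C (Cod C f) \<odot> f = f"
    using Comp_Ide Ide_Comp by (auto simp: Hom_def)
  have retr: "g \<odot> (h \<odot> r) = r" "g \<odot> (h \<odot> r') = r'"
    using arr h hA gA dc gh id2[of r] id2[of r'] by (auto simp: assoc)
  have cc': "commuting_cocone C p p' (h \<odot> r) (h \<odot> r')"
    using arr h(2) hA assoc[of p r h] assoc[of p' r' h]
    unfolding commuting_cocone_def by (auto simp: Comp_simps)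
  have "\<exists>!k. k \<in> Hom C (Cod C (h \<odot> r)) (Cod C u) \<and> k \<odot> (h \<odot> r) = u \<and> k \<odot> (h \<odot> r') = u'"
    if u: "commuting_cocone C p p' u u'" for u u'
  proof -
    have ch: "Cod C (h \<odot> r) = Cod C h" using arr h hA by (simp add: Comp_simps)
    from po u obtain k where k: "k \<in> Hom C (Cod C r) (Cod C u)" "k \<odot> r = u" "k \<odot> r' = u'"
      and uniq: "\<And>l. l \<in> Hom C (Cod C r) (Cod C u) \<Longrightarrow> l \<odot> r = u \<Longrightarrow> l \<odot> r' = u' \<Longrightarrow> l = k"
      unfolding is_pushout_def by blast
    show ?thesis
    proof (rule ex1I[of _ "k \<odot> g"], intro conjI)
      show "k \<odot> g \<in> Hom C (Cod C (h \<odot> r)) (Cod C u)"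
        using k gA dc ch by (auto simp: Hom_def Comp_simps)
      show "(k \<odot> g) \<odot> (h \<odot> r) = u" "(k \<odot> g) \<odot> (h \<odot> r') = u'"
        using assoc[of "h \<odot> r" g k] assoc[of "h \<odot> r'" g k] retr k gA hA dc arr h(2)
        by (auto simp: Hom_def Comp_simps)
    next
      fix l assume l: "l \<in> Hom C (Cod C (h \<odot> r)) (Cod C u) \<and> l \<odot> (h \<odot> r) = u \<and> l \<odot> (h \<odot> r') = u'"
      then have lA: "l \<in> Arr C" "Dom C l = Cod C h" "Cod C l = Cod C u"
        by (auto simp: Hom_def ch)
      have "l \<odot> h = k"
        using l lA h(2) hA arr assoc[of r h l] assoc[of r' h l]
        by (intro uniq) (auto simp: Hom_def Comp_simps)
      then have "k \<odot> g = l \<odot> (h \<odot> g)"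
        using assoc[of g h l] lA gA hA dc h(2) by simp
      then show "l = k \<odot> g" using hg id1[of l] lA by simp
    qed
  qed
  then show ?thesis using cc' by (simp add: is_pushout_def)
qed

lemma pushout_unique:
  assumes r: "is_pushout C p p' r r'" and s: "is_pushout C p p' s s'"
  obtains h where "is_iso C h" "Dom C h = Cod C r" "Cod C h = Cod C s" "h \<odot> r = s" "h \<odot> r' = s'"
proof -
  from r s have cr: "commuting_cocone C p p' r r'" and cs: "commuting_cocone C p p' s s'"
    by (auto simp: is_pushout_def)
  note arr = cr[unfolded commuting_cocone_def] cs[unfolded commuting_cocone_def]
  have inv: "g \<odot> h = Ide C (Cod C a)"
    if a: "is_pushout C p p' a a'"
      and h: "h \<in> Hom C (Cod C a) (Cod C b)" "h \<odot> a = b" "h \<odot> a' = b'"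
      and g: "g \<in> Hom C (Cod C b) (Cod C a)" "g \<odot> b = a" "g \<odot> b' = a'" for a a' b b' g h
  proof -
    have ca: "commuting_cocone C p p' a a'" using a by (simp add: is_pushout_def)
    note aa = ca[unfolded commuting_cocone_def]
    have i: "Ide C (Cod C a) \<in> Hom C (Cod C a) (Cod C a)"
      "Ide C (Cod C a) \<odot> a = a" "Ide C (Cod C a) \<odot> a' = a'"
      using aa Cod_in_Obj[of a] Ide_in_Hom Ide_Comp[of a] Ide_Comp[of a'] by (auto simp: Hom_def)
    have j: "g \<odot> h \<in> Hom C (Cod C a) (Cod C a)" "(g \<odot> h) \<odot> a = a" "(g \<odot> h) \<odot> a' = a'"
      using g h Comp_in_Hom[OF h(1) g(1)] assoc[of a h g] assoc[of a' h g] aa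
      by (auto simp: Hom_def)
    show ?thesis using a ca i j unfolding is_pushout_def by blast
  qed
  from r cs obtain h where h: "h \<in> Hom C (Cod C r) (Cod C s)" "h \<odot> r = s" "h \<odot> r' = s'"
    unfolding is_pushout_def by blast
  from s cr obtain g where g: "g \<in> Hom C (Cod C s) (Cod C r)" "g \<odot> s = r" "g \<odot> s' = r'"
    unfolding is_pushout_def by blast
  have "is_iso C h"
    using inv[OF r h g] inv[OF s g h] g(1) h(1) by (auto simp: is_iso_def Hom_def)
  with h that show thesis by (auto simp: Hom_def)
qed

end

lemma (in cat_functor) Fm_simps:
  assumes "f \<in> Arr C"
  shows "Fm f \<in> Arr D" "Dom D (Fm f) = Fo (Dom C f)" "Cod D (Fm f) = Fo (Cod C f)"
  using Fm_in_Hom[of f "Dom C f" "Cod C f"] assms by (auto simp: Hom_def)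

lemma (in cat_functor) Fm_iso:
  assumes "is_iso C h"
  shows "is_iso D (Fm h)"
proof -
  from assms obtain g where h: "h \<in> Hom C (Dom C h) (Cod C h)"
    and g: "g \<in> Hom C (Cod C h) (Dom C h)"
    and e: "g \<odot>\<^bsub>C\<^esub> h = Ide C (Dom C h)" "h \<odot>\<^bsub>C\<^esub> g = Ide C (Cod C h)"
    by (auto simp: is_iso_def Hom_def)
  have o: "Dom C h \<in> Obj C" "Cod C h \<in> Obj C"
    using h source.Dom_in_Obj source.Cod_in_Obj by (auto simp: Hom_def)
  have hA: "h \<in> Arr C" using h by (simp add: Hom_def)
  have "Fm g \<odot>\<^bsub>D\<^esub> Fm h = Ide D (Fo (Dom C h))" "Fm h \<odot>\<^bsub>D\<^esub> Fm g = Ide D (Fo (Cod C h))"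
    using Fm_Comp[OF h g] Fm_Comp[OF g h] e o Fm_Ide by simp_all
  then show ?thesis
    using Fm_in_Hom[OF g] Fm_simps[OF hA] unfolding is_iso_def by auto
qed

lemma absolute_pushout_cong:
  fixes T :: "('x, 'y) cat itself"
  assumes "category C" "is_absolute_pushout T C p p' r r'" "is_pushout C p p' s s'"
  shows "is_absolute_pushout T C p p' s s'"
proof -
  interpret category C by fact
  from assms(2) have r: "is_pushout C p p' r r'" by (simp add: is_absolute_pushout_def)
  obtain h where h: "is_iso C h" "Dom C h = Cod C r" "Cod C h = Cod C s"
      "h \<odot>\<^bsub>C\<^esub> r = s" "h \<odot>\<^bsub>C\<^esub> r' = s'"
    using pushout_unique[OF r assms(3)] by blast
  have arr: "h \<in> Arr C" "r \<in> Arr C" "r' \<in> Arr C" "Cod C r = Cod C r'"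
    using r h(1) by (auto simp: is_pushout_def commuting_cocone_def is_iso_def)
  have "is_pushout D (Fm p) (Fm p') (Fm s) (Fm s')" if "cat_functor C D Fo Fm" for D :: "('x, 'y) cat" and Fo Fm
  proof -
    interpret F: cat_functor C D Fo Fm by fact
    have "is_pushout D (Fm p) (Fm p') (Fm r) (Fm r')"
      using assms(2) that by (auto simp: is_absolute_pushout_def)
    moreover have "Fm s = Fm h \<odot>\<^bsub>D\<^esub> Fm r" "Fm s' = Fm h \<odot>\<^bsub>D\<^esub> Fm r'"
      using F.Fm_Comp[of r _ _ h] F.Fm_Comp[of r' _ _ h] h arr by (auto simp: Hom_def)
    ultimately show ?thesis
      using F.target.pushout_comp_iso F.Fm_iso[OF h(1)] F.Fm_simps arr h(2) by simp
  qed
  then show ?thesis using assms(3) by (simp add: is_absolute_pushout_def)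
qed


section \<open>Generalized Reedy categories\<close>

text \<open>Orthogonality: every commuting square from \<open>l\<close> to \<open>r\<close> has exactly one diagonal filler.\<close>

definition orthogonal :: "('o, 'm) cat \<Rightarrow> 'm \<Rightarrow> 'm \<Rightarrow> bool" where
  "orthogonal C l r \<longleftrightarrow>
     (\<forall>u \<in> Hom C (Dom C l) (Dom C r). \<forall>v \<in> Hom C (Cod C l) (Cod C r).
        r \<odot>\<^bsub>C\<^esub> u = v \<odot>\<^bsub>C\<^esub> l \<longrightarrow>
        (\<exists>!d. d \<in> Hom C (Cod C l) (Dom C r) \<and> d \<odot>\<^bsub>C\<^esub> l = u \<and> r \<odot>\<^bsub>C\<^esub> d = v))"

definition orthogonal_factorization_system :: "('o, 'm) cat \<Rightarrow> 'm set \<Rightarrow> 'm set \<Rightarrow> bool" where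
  "orthogonal_factorization_system C L R \<longleftrightarrow>
     L = {l \<in> Arr C. \<forall>r \<in> R. orthogonal C l r} \<and>
     R = {r \<in> Arr C. \<forall>l \<in> L. orthogonal C l r} \<and>
     (\<forall>f \<in> Arr C. \<exists>l \<in> L. \<exists>r \<in> R.
        Dom C l = Dom C f \<and> Cod C l = Dom C r \<and> Cod C r = Cod C f \<and> r \<odot>\<^bsub>C\<^esub> l = f)"

locale generalized_reedy_category = category A
  for A :: "('o, 'm) cat" (structure) +
  fixes Aminus Aplus :: "'m set" and deg :: "'o \<Rightarrow> nat"
  assumes factorization: "orthogonal_factorization_system A Aminus Aplus"
    and deg_iso: "is_iso A f \<Longrightarrow> deg (Dom A f) = deg (Cod A f)"
    and deg_minus: "f \<in> Aminus \<Longrightarrow> \<not> is_iso A f \<Longrightarrow> deg (Cod A f) < deg (Dom A f)"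
    and deg_plus: "f \<in> Aplus \<Longrightarrow> \<not> is_iso A f \<Longrightarrow> deg (Dom A f) < deg (Cod A f)"

locale eilenberg_zilber_category = generalized_reedy_category A Aminus Aplus deg
  for T :: "('x, 'y) cat itself"
    and A :: "('o, 'm) cat" (structure) and Aminus Aplus :: "'m set" and deg :: "'o \<Rightarrow> nat" +
  assumes absolute_pushouts:
    "p \<in> Aminus \<Longrightarrow> p' \<in> Aminus \<Longrightarrow> Dom A p = Dom A p' \<Longrightarrow>
       \<exists>r r'. is_absolute_pushout T A p p' r r'"

definition pseudo_sections :: "('o, 'm) cat \<Rightarrow> 'm \<Rightarrow> 'm set" where
  "pseudo_sections C p = {i \<in> Arr C. Cod C i = Dom C p \<and> is_iso C (p \<odot>\<^bsub>C\<^esub> i)}"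

definition pseudo_equal :: "('o, 'm) cat \<Rightarrow> 'm \<Rightarrow> 'm \<Rightarrow> bool" where
  "pseudo_equal C p p' \<longleftrightarrow>
     (\<exists>\<phi> \<in> Hom C (Cod C p) (Cod C p'). is_iso C \<phi> \<and> \<phi> \<odot>\<^bsub>C\<^esub> p = p')"

locale strongly_skeletal_reedy_category = generalized_reedy_category A Aminus Aplus deg
  for A :: "('o, 'm) cat" (structure) and Aminus Aplus :: "'m set" and deg :: "'o \<Rightarrow> nat" +
  assumes minus_split_epi: "p \<in> Aminus \<Longrightarrow> is_split_epi A p"
    and minus_pseudo_equal:
      "p \<in> Aminus \<Longrightarrow> p' \<in> Aminus \<Longrightarrow> Dom A p = Dom A p' \<Longrightarrow>
         pseudo_sections A p = pseudo_sections A p' \<Longrightarrow> pseudo_equal A p p'"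

end

theory Submission
  imports Defs
begin

text \<open>
  For a span \<open>p, p'\<close> out of \<open>a\<close>, let \<open>N\<close> be the set of endomorphisms of \<open>a\<close> that a zigzag of
  equalities after \<open>p\<close> or after \<open>p'\<close> connects to the identity. It is a left unitary submonoid and
  contains \<open>s p\<close> for every section \<open>s\<close> of \<open>p\<close>, and likewise for \<open>p'\<close>. An element of \<open>N\<close> whose image
  has least degree yields an idempotent \<open>\<sigma> g\<close> in \<open>N\<close>, with \<open>g \<sigma> = 1\<close>, such that \<open>g h \<sigma>\<close> is invertible
  for every \<open>h\<close> in \<open>N\<close>. Hence \<open>g h\<close> and \<open>g\<close> have the same pseudo-sections, so \<open>g h = \<phi> g\<close> with \<open>\<phi>\<close>
  invertible, and \<open>\<phi> = 1\<close> if \<open>h\<close> is idempotent. Taking \<open>h = s p\<close> shows that \<open>g\<close> factors through \<open>p\<close>,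
  and likewise through \<open>p'\<close>. Together with the zigzag from \<open>\<sigma> g\<close> to the identity, this describes the
  pushout of the span by equations, which every functor preserves.
\<close>

section \<open>Isomorphisms and split epimorphisms\<close>

context category
begin

lemma Comp_assoc_right:
  assumes "f \<in> Arr C" "g \<in> Arr C" "h \<in> Arr C" "Dom C g = Cod C f" "Dom C h = Cod C g"
  shows "(h \<odot> g) \<odot> f = h \<odot> (g \<odot> f)"
  using assoc[OF assms] by simp

lemma Ide_simps:
  assumes "a \<in> Obj C"
  shows "Ide C a \<in> Arr C" "Dom C (Ide C a) = a" "Cod C (Ide C a) = a"
  using Ide_in_Hom[OF assms] by (auto simp: Hom_def)

lemma Comp_Ide_right: "f \<in> Arr C \<Longrightarrow> Dom C f = a \<Longrightarrow> f \<odot> Ide C a = f"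
  using Comp_Ide by (auto simp: Hom_def)

lemma Comp_Ide_left: "f \<in> Arr C \<Longrightarrow> Cod C f = a \<Longrightarrow> Ide C a \<odot> f = f"
  using Ide_Comp by (auto simp: Hom_def)

lemmas cat_simps = Comp_simps Comp_assoc_right Ide_simps Comp_Ide_right Comp_Ide_left
  Dom_in_Obj Cod_in_Obj

lemma is_isoI:
  assumes "f \<in> Hom C a b" "g \<in> Hom C b a" "g \<odot> f = Ide C a" "f \<odot> g = Ide C b"
  shows "is_iso C f"
  using assms by (auto simp: is_iso_def Hom_def)

lemma is_isoE:
  assumes "is_iso C f"
  obtains g where "f \<in> Arr C" "g \<in> Arr C" "Dom C g = Cod C f" "Cod C g = Dom C f"
    "g \<odot> f = Ide C (Dom C f)" "f \<odot> g = Ide C (Cod C f)" "is_iso C g"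
  using assms by (auto simp: is_iso_def Hom_def)

lemma is_split_epiE:
  assumes "is_split_epi C p"
  obtains s where "p \<in> Arr C" "s \<in> Arr C" "Dom C s = Cod C p" "Cod C s = Dom C p"
    "p \<odot> s = Ide C (Cod C p)"
  using assms by (auto simp: is_split_epi_def Hom_def)

lemma is_split_epi_cancel:
  assumes "is_split_epi C p" "f \<in> Arr C" "g \<in> Arr C" "Dom C f = Cod C p" "Dom C g = Cod C p"
    and eq: "f \<odot> p = g \<odot> p"
  shows "f = g"
proof -
  obtain s where s: "p \<in> Arr C" "s \<in> Arr C" "Dom C s = Cod C p" "Cod C s = Dom C p"
    "p \<odot> s = Ide C (Cod C p)" using assms(1) by (rule is_split_epiE)
  have "f \<odot> (p \<odot> s) = g \<odot> (p \<odot> s)"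
    using s assms assoc[of s p f] assoc[of s p g] by simp
  then show ?thesis using s assms by (simp add: cat_simps)
qed

lemma is_iso_Comp:
  assumes "is_iso C f" "is_iso C g" "Dom C g = Cod C f"
  shows "is_iso C (g \<odot> f)"
proof -
  obtain f' where f: "f \<in> Arr C" "f' \<in> Arr C" "Dom C f' = Cod C f" "Cod C f' = Dom C f"
    "f' \<odot> f = Ide C (Dom C f)" "f \<odot> f' = Ide C (Cod C f)" using assms(1) by (rule is_isoE)
  obtain g' where g: "g \<in> Arr C" "g' \<in> Arr C" "Dom C g' = Cod C g" "Cod C g' = Dom C g"
    "g' \<odot> g = Ide C (Dom C g)" "g \<odot> g' = Ide C (Cod C g)" using assms(2) by (rule is_isoE)
  have "(f' \<odot> g') \<odot> (g \<odot> f) = f' \<odot> ((g' \<odot> g) \<odot> f)"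
    "(g \<odot> f) \<odot> (f' \<odot> g') = g \<odot> ((f \<odot> f') \<odot> g')"
    using f(1-4) g(1-4) assms(3) by (simp_all add: cat_simps)
  then show ?thesis
    using f g assms(3)
    by (intro is_isoI[of _ "Dom C f" "Cod C g" "f' \<odot> g'"]) (simp_all add: Hom_def cat_simps)
qed

lemma is_iso_cancel_right:
  assumes gf: "is_iso C (g \<odot> f)" and f: "is_iso C f" and g: "g \<in> Arr C" "Dom C g = Cod C f"
  shows "is_iso C g"
proof -
  obtain k where k: "f \<in> Arr C" "k \<in> Arr C" "Dom C k = Cod C f" "Cod C k = Dom C f"
    "f \<odot> k = Ide C (Cod C f)" "is_iso C k" using f by (rule is_isoE)
  have "is_iso C ((g \<odot> f) \<odot> k)" using k g by (intro is_iso_Comp[OF k(6) gf]) (simp add: cat_simps)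
  then show ?thesis using k g by (simp add: cat_simps)
qed

text \<open>Since \<open>q\<close> is epic, \<open>q m q = q\<close> cancels to
  \<open>q m = 1\<close>.\<close>

lemma split_mono_split_epi_is_iso:
  assumes q: "is_split_epi C q" and m: "m \<in> Arr C" "Dom C m = Cod C q" "m \<odot> q = Ide C (Dom C q)"
  shows "is_iso C q"
proof -
  have qA: "q \<in> Arr C" using q by (simp add: is_split_epi_def)
  have cm: "Cod C m = Dom C q"
    using Comp_simps(3)[of q m] qA m by (simp add: Ide_simps Dom_in_Obj)
  have "q \<odot> m = Ide C (Cod C q)"
    by (rule is_split_epi_cancel[OF q]) (use qA m cm in \<open>simp_all add: cat_simps\<close>)
  then show ?thesis
    using qA m cm by (auto simp: is_iso_def Hom_def)
qed

text \<open>A square on \<open>h l\<close> with bottom \<open>v\<close> is a square on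
  \<open>l\<close> with bottom \<open>v h\<close>; the fillers correspond by composition with
  \<open>h\<close> and its inverse \<open>k\<close>.\<close>

lemma orthogonal_iso_Comp:
  assumes orth: "orthogonal C l r" and h: "is_iso C h" "Dom C h = Cod C l"
    and arr: "l \<in> Arr C" "r \<in> Arr C"
  shows "orthogonal C (h \<odot> l) r"
proof -
  obtain k where k: "h \<in> Arr C" "k \<in> Arr C" "Dom C k = Cod C h" "Cod C k = Dom C h"
    "k \<odot> h = Ide C (Dom C h)" "h \<odot> k = Ide C (Cod C h)" using h(1) by (rule is_isoE)
  have khl: "k \<odot> (h \<odot> l) = l"
    using k h arr by (simp add: Comp_assoc_right[symmetric] cat_simps)
  show ?thesis
    unfolding orthogonal_def
  proof (intro ballI impI)
    fix u v
    assume u: "u \<in> Hom C (Dom C (h \<odot> l)) (Dom C r)" and v: "v \<in> Hom C (Cod C (h \<odot> l)) (Cod C r)"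
      and sq: "r \<odot> u = v \<odot> (h \<odot> l)"
    note t = u[unfolded Hom_def] v[unfolded Hom_def] k arr h(2)
    have "u \<in> Hom C (Dom C l) (Dom C r)" "v \<odot> h \<in> Hom C (Cod C l) (Cod C r)"
      "r \<odot> u = (v \<odot> h) \<odot> l"
      using t sq by (auto simp: Hom_def cat_simps)
    then obtain d where d: "d \<in> Hom C (Cod C l) (Dom C r)" "d \<odot> l = u" "r \<odot> d = v \<odot> h"
      and uniq: "\<And>e. e \<in> Hom C (Cod C l) (Dom C r) \<Longrightarrow> e \<odot> l = u \<Longrightarrow> r \<odot> e = v \<odot> h \<Longrightarrow> e = d"
      using orth unfolding orthogonal_def by blast
    show "\<exists>!d. d \<in> Hom C (Cod C (h \<odot> l)) (Dom C r) \<and> d \<odot> (h \<odot> l) = u \<and> r \<odot> d = v"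
    proof (rule ex1I[of _ "d \<odot> k"], intro conjI)
      show "d \<odot> k \<in> Hom C (Cod C (h \<odot> l)) (Dom C r)"
        using d(1) t by (auto simp: Hom_def cat_simps)
      show "(d \<odot> k) \<odot> (h \<odot> l) = u"
        using d(1,2) t khl by (simp add: Hom_def cat_simps)
      have "r \<odot> (d \<odot> k) = (r \<odot> d) \<odot> k"
        using d(1) t by (simp add: Hom_def cat_simps)
      also have "\<dots> = v" using d(3) t by (simp add: cat_simps)
      finally show "r \<odot> (d \<odot> k) = v" .
    next
      fix e assume e: "e \<in> Hom C (Cod C (h \<odot> l)) (Dom C r) \<and> e \<odot> (h \<odot> l) = u \<and> r \<odot> e = v"
      then have eA: "e \<in> Arr C" "Dom C e = Cod C h" "Cod C e = Dom C r"
        using t by (auto simp: Hom_def cat_simps)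
      have "e \<odot> h = d"
      proof (rule uniq)
        show "e \<odot> h \<in> Hom C (Cod C l) (Dom C r)" using eA t by (simp add: Hom_def cat_simps)
        show "(e \<odot> h) \<odot> l = u" using eA t e by (simp add: cat_simps)
        show "r \<odot> (e \<odot> h) = v \<odot> h"
          using eA t e Comp_assoc_right[of h e r] by simp
      qed
      then have "d \<odot> k = (e \<odot> h) \<odot> k" by simp
      then show "e = d \<odot> k" using eA k by (simp add: cat_simps)
    qed
  qed
qed

end


section \<open>An equational criterion for absolute pushouts\<close>

text \<open>When \<open>p\<close> and \<open>p'\<close> are split epimorphisms with common domain,
  the classes of arrows out of \<open>x\<close> form the pushout of the span of hom-sets out of
  \<open>x\<close>. Reflexivity on arrows into \<open>Dom C p\<close> is an instance of
  \<open>left\<close>.\<close>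

inductive span_equiv :: "('o, 'm) cat \<Rightarrow> 'm \<Rightarrow> 'm \<Rightarrow> 'm \<Rightarrow> 'm \<Rightarrow> bool" for C p p' where
  left: "f \<in> Hom C x (Dom C p) \<Longrightarrow> f' \<in> Hom C x (Dom C p) \<Longrightarrow> p \<odot>\<^bsub>C\<^esub> f = p \<odot>\<^bsub>C\<^esub> f' \<Longrightarrow>
    span_equiv C p p' f f'"
| right: "f \<in> Hom C x (Dom C p') \<Longrightarrow> f' \<in> Hom C x (Dom C p') \<Longrightarrow> p' \<odot>\<^bsub>C\<^esub> f = p' \<odot>\<^bsub>C\<^esub> f' \<Longrightarrow>
    span_equiv C p p' f f'"
| sym: "span_equiv C p p' f f' \<Longrightarrow> span_equiv C p p' f' f"
| trans: "span_equiv C p p' f f' \<Longrightarrow> span_equiv C p p' f' f'' \<Longrightarrow> span_equiv C p p' f f''"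

text \<open>An analogue of split coequalizers: sections and a finite zigzag witness the universal
  property, so that it rests on equations alone.\<close>

definition is_split_pushout :: "('o, 'm) cat \<Rightarrow> 'm \<Rightarrow> 'm \<Rightarrow> 'm \<Rightarrow> 'm \<Rightarrow> bool" where
  "is_split_pushout C p p' r r' \<longleftrightarrow>
     commuting_cocone C p p' r r' \<and> is_split_epi C p \<and> is_split_epi C p' \<and>
     (\<exists>\<sigma> \<in> Hom C (Cod C r) (Dom C p). (r \<odot>\<^bsub>C\<^esub> p) \<odot>\<^bsub>C\<^esub> \<sigma> = Ide C (Cod C r) \<and>
        span_equiv C p p' (\<sigma> \<odot>\<^bsub>C\<^esub> (r \<odot>\<^bsub>C\<^esub> p)) (Ide C (Dom C p)))"

context category
begin

text \<open>The equality of domains belongs to the conclusion because, in the case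
  \<open>trans\<close>, the second induction hypothesis asks that \<open>h\<close> be composable
  with the middle arrow.\<close>

lemma span_equiv_precomp:
  assumes "span_equiv C p p' f f'" "p \<in> Arr C" "p' \<in> Arr C" "h \<in> Arr C" "Cod C h = Dom C f"
  shows "span_equiv C p p' (f \<odot> h) (f' \<odot> h) \<and> Dom C f' = Dom C f"
  using assms
proof (induction rule: span_equiv.induct)
  case (left f x f')
  then have "p \<odot> (f \<odot> h) = p \<odot> (f' \<odot> h)"
    using assoc[of h f p] assoc[of h f' p] by (simp add: Hom_def)
  with left show ?case
    by (auto simp: Hom_def cat_simps intro!: span_equiv.left[of _ _ "Dom C h"])
next
  case (right f x f')
  then have "p' \<odot> (f \<odot> h) = p' \<odot> (f' \<odot> h)"
    using assoc[of h f p'] assoc[of h f' p'] by (simp add: Hom_def)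
  with right show ?case
    by (auto simp: Hom_def cat_simps intro!: span_equiv.right[of _ _ "Dom C h"])
next
  case (sym f f')
  \<comment> \<open>Here \<open>h\<close> is composable with \<open>f'\<close>, whereas the
    induction hypothesis wants it composable with \<open>f\<close>; a separate induction closes the
    gap.\<close>
  have "Dom C f' = Dom C f"
    using sym.hyps by induction (auto simp: Hom_def)
  with sym show ?case by (auto intro: span_equiv.sym)
next
  case (trans f f' f'')
  then show ?case by (auto intro: span_equiv.trans)
qed

text \<open>The diagonal \<open>u p = u' p'\<close> identifies what \<open>p\<close> identifies and
  also what \<open>p'\<close> identifies.\<close>

lemma cocone_Comp_span_equiv:
  assumes "span_equiv C p p' f f'" "commuting_cocone C p p' u u'"
  shows "(u \<odot> p) \<odot> f = (u \<odot> p) \<odot> f'"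
  using assms
proof (induction rule: span_equiv.induct)
  case (left f x f')
  then have "(u \<odot> p) \<odot> f = u \<odot> (p \<odot> f)" "(u \<odot> p) \<odot> f' = u \<odot> (p \<odot> f')"
    by (intro Comp_assoc_right; simp add: commuting_cocone_def Hom_def)+
  with left show ?case by simp
next
  case (right f x f')
  then have "(u' \<odot> p') \<odot> f = u' \<odot> (p' \<odot> f)" "(u' \<odot> p') \<odot> f' = u' \<odot> (p' \<odot> f')"
    by (intro Comp_assoc_right; simp add: commuting_cocone_def Hom_def)+
  with right show ?case by (simp add: commuting_cocone_def)
qed simp_all

text \<open>The mediating arrow is \<open>u p \<sigma>\<close>. The zigzag gives
  \<open>u p \<sigma> r p = u p\<close>, from which the split epimorphisms are cancelled; uniqueness
  comes from \<open>r p \<sigma> = 1\<close>.\<close>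

lemma split_pushout_is_pushout:
  assumes "is_split_pushout C p p' r r'"
  shows "is_pushout C p p' r r'"
proof -
  from assms obtain \<sigma> where cc: "commuting_cocone C p p' r r'"
    and epi: "is_split_epi C p" "is_split_epi C p'"
    and \<sigma>: "\<sigma> \<in> Arr C" "Dom C \<sigma> = Cod C r" "Cod C \<sigma> = Dom C p"
    and ret: "(r \<odot> p) \<odot> \<sigma> = Ide C (Cod C r)"
    and eqv: "span_equiv C p p' (\<sigma> \<odot> (r \<odot> p)) (Ide C (Dom C p))"
    by (auto simp: is_split_pushout_def Hom_def)
  note c = cc[unfolded commuting_cocone_def]
  have "\<exists>!h. h \<in> Hom C (Cod C r) (Cod C u) \<and> h \<odot> r = u \<and> h \<odot> r' = u'"
    if u: "commuting_cocone C p p' u u'" for u u'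
  proof -
    note t = u[unfolded commuting_cocone_def]
    define h where "h = (u \<odot> p) \<odot> \<sigma>"
    have hA: "h \<in> Hom C (Cod C r) (Cod C u)" using t c \<sigma> by (simp add: h_def Hom_def Comp_simps)
    have "h \<odot> (r \<odot> p) = (u \<odot> p) \<odot> (\<sigma> \<odot> (r \<odot> p))"
      unfolding h_def using t c \<sigma> by (intro Comp_assoc_right) (simp_all add: Comp_simps)
    also have "\<dots> = (u \<odot> p) \<odot> Ide C (Dom C p)"
      using eqv u by (rule cocone_Comp_span_equiv)
    also have "\<dots> = u \<odot> p" using t by (simp add: Comp_Ide_right Comp_simps)
    finally have key: "h \<odot> (r \<odot> p) = u \<odot> p" .
    have key': "h \<odot> (r' \<odot> p') = u' \<odot> p'" using key c t by simp
    show ?thesis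
    proof (rule ex1I[of _ h], intro conjI)
      show "h \<in> Hom C (Cod C r) (Cod C u)" by fact
      show "h \<odot> r = u"
        by (rule is_split_epi_cancel[OF epi(1)])
          (use key hA t c Comp_assoc_right[of p r h] in \<open>simp_all add: Hom_def Comp_simps\<close>)
      show "h \<odot> r' = u'"
        by (rule is_split_epi_cancel[OF epi(2)])
          (use key' hA t c Comp_assoc_right[of p' r' h] in \<open>simp_all add: Hom_def Comp_simps\<close>)
    next
      fix k assume k: "k \<in> Hom C (Cod C r) (Cod C u) \<and> k \<odot> r = u \<and> k \<odot> r' = u'"
      have "h = k \<odot> ((r \<odot> p) \<odot> \<sigma>)"
        unfolding h_def using k c \<sigma> assoc[of p r k] assoc[of \<sigma> "r \<odot> p" k]
        by (simp add: Hom_def Comp_simps)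
      then show "k = h" using k ret by (simp add: Hom_def Comp_Ide_right)
    qed
  qed
  with cc show ?thesis by (simp add: is_pushout_def)
qed

end

section \<open>Preservation of split pushouts by functors\<close>

context cat_functor
begin

lemma Fm_Comp_Arr:
  assumes "f \<in> Arr C" "g \<in> Arr C" "Dom C g = Cod C f"
  shows "Fm (g \<odot>\<^bsub>C\<^esub> f) = Fm g \<odot>\<^bsub>D\<^esub> Fm f"
  using Fm_Comp[of f "Dom C f" "Cod C f" g "Cod C g"] assms by (simp add: Hom_def)

lemma Fm_split_epi: "is_split_epi C p \<Longrightarrow> is_split_epi D (Fm p)"
proof (erule source.is_split_epiE)
  fix s assume s: "p \<in> Arr C" "s \<in> Arr C" "Dom C s = Cod C p" "Cod C s = Dom C p"
    "p \<odot>\<^bsub>C\<^esub> s = Ide C (Cod C p)"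
  have "Fm p \<odot>\<^bsub>D\<^esub> Fm s = Ide D (Fo (Cod C p))"
    using Fm_Comp_Arr[of s p] s by (simp add: Fm_Ide source.Cod_in_Obj)
  then show "is_split_epi D (Fm p)"
    using s by (auto simp: is_split_epi_def Hom_def Fm_simps intro!: exI[of _ "Fm s"])
qed

lemma Fm_span_equiv:
  assumes "span_equiv C p p' f f'" "p \<in> Arr C" "p' \<in> Arr C"
  shows "span_equiv D (Fm p) (Fm p') (Fm f) (Fm f')"
  using assms
proof (induction rule: span_equiv.induct)
  case (left f x f')
  have "Fm p \<odot>\<^bsub>D\<^esub> Fm f = Fm p \<odot>\<^bsub>D\<^esub> Fm f'"
    using left Fm_Comp_Arr[of f p] Fm_Comp_Arr[of f' p] by (simp add: Hom_def)
  with left show ?case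
    by (intro span_equiv.left[of _ _ "Fo x"]) (auto simp: Hom_def Fm_simps)
next
  case (right f x f')
  have "Fm p' \<odot>\<^bsub>D\<^esub> Fm f = Fm p' \<odot>\<^bsub>D\<^esub> Fm f'"
    using right Fm_Comp_Arr[of f p'] Fm_Comp_Arr[of f' p'] by (simp add: Hom_def)
  with right show ?case
    by (intro span_equiv.right[of _ _ "Fo x"]) (auto simp: Hom_def Fm_simps)
qed (auto intro: span_equiv.sym span_equiv.trans)

lemma Fm_split_pushout:
  assumes "is_split_pushout C p p' r r'"
  shows "is_split_pushout D (Fm p) (Fm p') (Fm r) (Fm r')"
proof -
  from assms obtain \<sigma> where cc: "commuting_cocone C p p' r r'"
    and epi: "is_split_epi C p" "is_split_epi C p'"
    and \<sigma>: "\<sigma> \<in> Arr C" "Dom C \<sigma> = Cod C r" "Cod C \<sigma> = Dom C p"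
    and ret: "(r \<odot>\<^bsub>C\<^esub> p) \<odot>\<^bsub>C\<^esub> \<sigma> = Ide C (Cod C r)"
    and eqv: "span_equiv C p p' (\<sigma> \<odot>\<^bsub>C\<^esub> (r \<odot>\<^bsub>C\<^esub> p)) (Ide C (Dom C p))"
    by (auto simp: is_split_pushout_def Hom_def)
  note c = cc[unfolded commuting_cocone_def]
  have rp: "Fm (r \<odot>\<^bsub>C\<^esub> p) = Fm r \<odot>\<^bsub>D\<^esub> Fm p" and rp': "Fm (r' \<odot>\<^bsub>C\<^esub> p') = Fm r' \<odot>\<^bsub>D\<^esub> Fm p'"
    using c by (intro Fm_Comp_Arr; simp)+
  have "commuting_cocone D (Fm p) (Fm p') (Fm r) (Fm r')"
    unfolding commuting_cocone_def rp[symmetric] rp'[symmetric] using c by (simp add: Fm_simps)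
  moreover have "Fm (\<sigma> \<odot>\<^bsub>C\<^esub> (r \<odot>\<^bsub>C\<^esub> p)) = Fm \<sigma> \<odot>\<^bsub>D\<^esub> (Fm r \<odot>\<^bsub>D\<^esub> Fm p)"
    "Fm ((r \<odot>\<^bsub>C\<^esub> p) \<odot>\<^bsub>C\<^esub> \<sigma>) = (Fm r \<odot>\<^bsub>D\<^esub> Fm p) \<odot>\<^bsub>D\<^esub> Fm \<sigma>"
    using c \<sigma> rp Fm_Comp_Arr[of "r \<odot>\<^bsub>C\<^esub> p" \<sigma>] Fm_Comp_Arr[of \<sigma> "r \<odot>\<^bsub>C\<^esub> p"]
    by (simp_all add: source.Comp_simps)
  moreover have "Fm \<sigma> \<in> Hom D (Cod D (Fm r)) (Dom D (Fm p))"
    using \<sigma> c by (simp add: Hom_def Fm_simps)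
  ultimately show ?thesis
    using Fm_span_equiv[OF eqv] Fm_split_epi epi c ret
    unfolding is_split_pushout_def by (auto simp: Fm_simps Fm_Ide source.Cod_in_Obj source.Dom_in_Obj)
qed

end

lemma (in category) split_pushout_is_absolute:
  fixes T :: "('x, 'y) cat itself"
  assumes "is_split_pushout C p p' r r'"
  shows "is_absolute_pushout T C p p' r r'"
proof -
  have "is_pushout D (Fm p) (Fm p') (Fm r) (Fm r')" if "cat_functor C D Fo Fm"
    for D :: "('x, 'y) cat" and Fo Fm
  proof -
    interpret F: cat_functor C D Fo Fm by fact
    show ?thesis using F.Fm_split_pushout[OF assms] by (rule F.target.split_pushout_is_pushout)
  qed
  then show ?thesis
    using split_pushout_is_pushout[OF assms] by (simp add: is_absolute_pushout_def)
qed


section \<open>Left unitary submonoids of endomorphism monoids\<close>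

text \<open>These closure properties are all that the argument on least degree uses of the span. The
  last one is left unitarity in the sense of semigroup theory.\<close>

definition left_unitary_submonoid :: "('o, 'm) cat \<Rightarrow> 'o \<Rightarrow> 'm set \<Rightarrow> bool" where
  "left_unitary_submonoid C a N \<longleftrightarrow> N \<subseteq> Hom C a a \<and> Ide C a \<in> N \<and>
     (\<forall>f \<in> N. \<forall>g \<in> N. f \<odot>\<^bsub>C\<^esub> g \<in> N) \<and>
     (\<forall>f \<in> N. \<forall>g \<in> Hom C a a. f \<odot>\<^bsub>C\<^esub> g \<in> N \<longrightarrow> g \<in> N)"

text \<open>Precomposing a zigzag from \<open>f\<close> to \<open>1\<close> with \<open>g\<close>
  links \<open>f g\<close> to \<open>g\<close>. So, for such \<open>f\<close>, the arrows
  \<open>f g\<close> and \<open>g\<close> are linked to \<open>1\<close> together, which gives both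
  closure under products and left unitarity.\<close>

lemma (in category) left_unitary_span_equiv_Ide:
  assumes p: "p \<in> Arr C" "p' \<in> Arr C" "Dom C p = a" "Dom C p' = a"
  shows "left_unitary_submonoid C a {f \<in> Hom C a a. span_equiv C p p' f (Ide C a)}"
proof -
  have a: "a \<in> Obj C" using p Dom_in_Obj by blast
  have ide: "span_equiv C p p' (Ide C a) (Ide C a)"
    by (rule span_equiv.left[of _ _ a]) (use a p Ide_in_Hom in auto)
  have pre: "span_equiv C p p' (f \<odot> g) g"
    if "f \<in> Hom C a a" "span_equiv C p p' f (Ide C a)" "g \<in> Hom C a a" for f g
    using span_equiv_precomp[OF that(2) p(1,2), of g] that by (simp add: Hom_def cat_simps)
  show ?thesis
    unfolding left_unitary_submonoid_def
    using a ide Ide_in_Hom Comp_in_Hom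
    by (auto intro: span_equiv.trans[OF pre] span_equiv.trans[OF span_equiv.sym[OF pre]])
qed

section \<open>Endomorphisms of least rank in a generalized Reedy category\<close>

context generalized_reedy_category
begin

lemma factorE:
  assumes "f \<in> Hom A a b"
  obtains e q m where "q \<in> Aminus" "m \<in> Aplus" "q \<in> Hom A a e" "m \<in> Hom A e b" "m \<odot> q = f"
proof -
  have "f \<in> Arr A" "Dom A f = a" "Cod A f = b" using assms by (auto simp: Hom_def)
  moreover have "Aminus \<subseteq> Arr A" "Aplus \<subseteq> Arr A"
    using factorization unfolding orthogonal_factorization_system_def by blast+
  ultimately obtain q m where "q \<in> Aminus" "m \<in> Aplus" "Dom A q = a" "Cod A q = Dom A m"
    "Cod A m = b" "m \<odot> q = f" "q \<in> Arr A" "m \<in> Arr A"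
    using factorization unfolding orthogonal_factorization_system_def by blast
  then show thesis by (intro that[of q m "Dom A m"]) (auto simp: Hom_def)
qed

text \<open>\<open>Aminus\<close> is the class of all arrows left orthogonal to
  \<open>Aplus\<close>, and orthogonality survives composition with an isomorphism.\<close>

lemma Aminus_iso_Comp:
  assumes "q \<in> Aminus" "is_iso A h" "Dom A h = Cod A q"
  shows "h \<odot> q \<in> Aminus"
proof -
  have L: "Aminus = {l \<in> Arr A. \<forall>r \<in> Aplus. orthogonal A l r}" and R: "Aplus \<subseteq> Arr A"
    using factorization unfolding orthogonal_factorization_system_def by blast+
  have "q \<in> Arr A" "h \<in> Arr A" using assms L by (auto simp: is_iso_def)
  then have "h \<odot> q \<in> Arr A" using assms by (simp add: Comp_simps)
  then show ?thesis
    using assms \<open>q \<in> Arr A\<close> L R orthogonal_iso_Comp[of q _ h] by blast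
qed

text \<open>In the factorization \<open>u = m q\<close>, the arrow \<open>q\<close> cannot lower the
  degree, so it is invertible. Then \<open>m\<close> joins objects of equal degree, so it is
  invertible too.\<close>

lemma is_iso_of_minimal_rank:
  assumes u: "u \<in> Hom A c c"
    and rank: "\<And>e q m. q \<in> Hom A c e \<Longrightarrow> m \<in> Hom A e c \<Longrightarrow> m \<odot> q = u \<Longrightarrow> deg c \<le> deg e"
  shows "is_iso A u"
proof -
  obtain e q m where f: "q \<in> Aminus" "m \<in> Aplus" "q \<in> Hom A c e" "m \<in> Hom A e c" "m \<odot> q = u"
    using u by (rule factorE)
  have le: "deg c \<le> deg e" using f(3-5) by (rule rank)
  then have q: "is_iso A q" using deg_minus[OF f(1)] f(3) by (auto simp: Hom_def)
  then have "deg e = deg c" using deg_iso[of q] f(3) by (simp add: Hom_def)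
  then have "is_iso A m" using deg_plus[OF f(2)] f(4) by (auto simp: Hom_def)
  then show ?thesis using q is_iso_Comp[of q m] f by (auto simp: Hom_def)
qed

text \<open>
  An element of least rank generates a minimal ideal, as in the structure theory of finite monoids,
  with degree playing the role of rank. Left unitarity puts an idempotent of this ideal into \<open>N\<close>.
\<close>

lemma minimal_retract:
  assumes N: "left_unitary_submonoid A a N" and a: "a \<in> Obj A"
  obtains d g \<sigma> where "g \<in> Hom A a d" "\<sigma> \<in> Hom A d a" "g \<odot> \<sigma> = Ide A d" "\<sigma> \<odot> g \<in> N"
    "\<And>h. h \<in> N \<Longrightarrow> is_iso A (g \<odot> (h \<odot> \<sigma>))"
proof -
  have sub: "\<And>f. f \<in> N \<Longrightarrow> f \<in> Hom A a a" and one: "Ide A a \<in> N"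
    and mult: "\<And>f g. f \<in> N \<Longrightarrow> g \<in> N \<Longrightarrow> f \<odot> g \<in> N"
    and unit: "\<And>f g. f \<in> N \<Longrightarrow> g \<in> Hom A a a \<Longrightarrow> f \<odot> g \<in> N \<Longrightarrow> g \<in> N"
    using N unfolding left_unitary_submonoid_def by blast+
  \<comment> \<open>Triples record factorizations of elements of \<open>N\<close>; that of the
    identity through \<open>a\<close> shows that there is one, and one with middle object
    \<open>c\<close> of least degree is chosen.\<close>
  let ?P = "\<lambda>(c, q, m). q \<in> Hom A a c \<and> m \<in> Hom A c a \<and> m \<odot> q \<in> N"
  have "?P (a, Ide A a, Ide A a)"
    using a one Ide_in_Hom by (simp add: cat_simps)
  from ex_has_least_nat[of ?P, OF this, of "\<lambda>t. deg (fst t)"]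
  obtain c q m where q: "q \<in> Hom A a c" and m: "m \<in> Hom A c a" and mq: "m \<odot> q \<in> N"
    and least: "\<And>e q m. q \<in> Hom A a e \<Longrightarrow> m \<in> Hom A e a \<Longrightarrow> m \<odot> q \<in> N \<Longrightarrow> deg c \<le> deg e"
    by fastforce
  note t = q[unfolded Hom_def] m[unfolded Hom_def]
  \<comment> \<open>If \<open>q' m'\<close> sits in the middle of an element of \<open>N\<close>, a
    factorization of it through \<open>e\<close> also factors that element through \<open>e\<close>,
    so \<open>e\<close> has degree at least that of \<open>c\<close>.\<close>
  have iso: "is_iso A (q' \<odot> m')"
    if q': "q' \<in> Hom A a c" and m': "m' \<in> Hom A c a"
      and mid: "m'' \<in> Hom A c a" "q'' \<in> Hom A a c" "(m'' \<odot> (q' \<odot> m')) \<odot> q'' \<in> N" for q' m' m'' q''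
  proof (rule is_iso_of_minimal_rank[of _ c])
    show "q' \<odot> m' \<in> Hom A c c" using q' m' by (simp add: Hom_def cat_simps)
    fix e k l assume kl: "k \<in> Hom A c e" "l \<in> Hom A e c" "l \<odot> k = q' \<odot> m'"
    have "(m'' \<odot> l) \<odot> (k \<odot> q'') = (m'' \<odot> (l \<odot> k)) \<odot> q''"
      using kl(1,2) mid(1,2) by (simp add: Hom_def cat_simps)
    with mid(3) kl(3) have "(m'' \<odot> l) \<odot> (k \<odot> q'') \<in> N" by simp
    then show "deg c \<le> deg e" using kl(1,2) mid(1,2) Comp_in_Hom by (blast intro: least)
  qed
  \<comment> \<open>The square of \<open>m q\<close> lies in \<open>N\<close> and has
    \<open>q m\<close> in its middle.\<close>
  have "(m \<odot> (q \<odot> m)) \<odot> q = (m \<odot> q) \<odot> (m \<odot> q)"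
    using t by (simp add: cat_simps)
  then have "is_iso A (q \<odot> m)"
    using q m mq mult by (intro iso[of q m m q]) auto
  then obtain k where k: "k \<in> Arr A" "Dom A k = c" "Cod A k = c"
    "k \<odot> (q \<odot> m) = Ide A c" "(q \<odot> m) \<odot> k = Ide A c"
    by (rule is_isoE) (use t in \<open>simp add: cat_simps\<close>)
  \<comment> \<open>Correcting \<open>q\<close> by the inverse \<open>k\<close> of
    \<open>q m\<close> makes it a retraction of \<open>m\<close>.\<close>
  define g where "g = k \<odot> q"
  have g: "g \<in> Hom A a c" using t k by (simp add: g_def Hom_def cat_simps)
  have gm: "g \<odot> m = Ide A c" using t k by (simp add: g_def cat_simps)
  \<comment> \<open>Left unitarity applies because \<open>(m q) (m g) = m q\<close> lies in
    \<open>N\<close>.\<close>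
  have "(m \<odot> q) \<odot> (m \<odot> g) = m \<odot> (((q \<odot> m) \<odot> k) \<odot> q)"
    using t k(1-3) by (simp add: g_def cat_simps)
  also have "\<dots> = m \<odot> q" using t k(5) by (simp add: cat_simps)
  finally have mg: "m \<odot> g \<in> N"
    using unit[OF mq, of "m \<odot> g"] mq m g by (simp add: Hom_def cat_simps)
  show thesis
  proof (rule that[OF g m gm mg])
    fix h assume h: "h \<in> N"
    \<comment> \<open>The endomorphism \<open>g h m\<close> sits in the middle of
      \<open>(m g) h (m g)\<close>, an element of \<open>N\<close>.\<close>
    have "(m \<odot> (g \<odot> (h \<odot> m))) \<odot> g = (m \<odot> g) \<odot> (h \<odot> (m \<odot> g))"
      using g m sub[OF h] by (simp add: Hom_def cat_simps)
    also have "\<dots> \<in> N" using h mg mult by blast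
    finally show "is_iso A (g \<odot> (h \<odot> m))"
      using g m sub[OF h] by (intro iso[of g "h \<odot> m" m g]) (auto simp: Hom_def cat_simps)
  qed
qed

end

section \<open>Pseudo-sections, absorbed idempotents and the pushout\<close>

context strongly_skeletal_reedy_category
begin

text \<open>Write \<open>p = m q\<close> and \<open>q s = m' q'\<close>. From
  \<open>m m' q' = p s = 1\<close>, the arrow \<open>q'\<close> is invertible, being a split
  epimorphism with a retraction. Hence \<open>deg (Cod A p) = deg e \<le> deg c\<close>, which
  forces \<open>m\<close> to be invertible. This makes the axiom on pseudo-sections available for
  \<open>g\<close> and \<open>g h\<close>.\<close>

lemma split_epi_in_Aminus:
  assumes "is_split_epi A p"
  shows "p \<in> Aminus"
proof -
  obtain s where p: "p \<in> Arr A" "s \<in> Arr A" "Dom A s = Cod A p" "Cod A s = Dom A p"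
    "p \<odot> s = Ide A (Cod A p)" using assms by (rule is_split_epiE)
  obtain c q m where f: "q \<in> Aminus" "m \<in> Aplus" "q \<in> Hom A (Dom A p) c"
    "m \<in> Hom A c (Cod A p)" "m \<odot> q = p"
    using factorE[of p "Dom A p" "Cod A p"] p by (auto simp: Hom_def)
  have "q \<odot> s \<in> Hom A (Cod A p) c" using f p by (simp add: Hom_def cat_simps)
  then obtain e q' m' where f': "q' \<in> Aminus" "m' \<in> Aplus" "q' \<in> Hom A (Cod A p) e"
    "m' \<in> Hom A e c" "m' \<odot> q' = q \<odot> s" by (rule factorE)
  have "(m \<odot> m') \<odot> q' = m \<odot> (m' \<odot> q')" using f f' by (simp add: Hom_def cat_simps)
  also have "\<dots> = (m \<odot> q) \<odot> s"
    unfolding f' using f(3,4) p(1-4) by (simp add: Hom_def cat_simps)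
  finally have "(m \<odot> m') \<odot> q' = Ide A (Cod A p)" using f p by simp
  then have "is_iso A q'"
    using split_mono_split_epi_is_iso[OF minus_split_epi[OF f'(1)], of "m \<odot> m'"] f f'
    by (simp add: Hom_def cat_simps)
  then have "deg (Cod A p) = deg e" using deg_iso[of q'] f'(3) by (simp add: Hom_def)
  moreover have "deg e \<le> deg c"
    using deg_plus[OF f'(2)] deg_iso[of m'] f'(4) by (cases "is_iso A m'") (auto simp: Hom_def)
  ultimately have "is_iso A m" using deg_plus[OF f(2)] f(4) by (auto simp: Hom_def)
  then have "m \<odot> q \<in> Aminus" using f by (intro Aminus_iso_Comp) (auto simp: Hom_def)
  then show ?thesis using f by simp
qed

lemma minimal_retract_absorbs_idempotents:
  assumes N: "left_unitary_submonoid A a N" and a: "a \<in> Obj A"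
  obtains d g \<sigma> where "g \<in> Hom A a d" "\<sigma> \<in> Hom A d a" "g \<odot> \<sigma> = Ide A d" "\<sigma> \<odot> g \<in> N"
    "\<And>h. h \<in> N \<Longrightarrow> h \<odot> h = h \<Longrightarrow> g \<odot> h = g"
proof -
  have sub: "\<And>f. f \<in> N \<Longrightarrow> f \<in> Hom A a a" and one: "Ide A a \<in> N"
    and mult: "\<And>f g. f \<in> N \<Longrightarrow> g \<in> N \<Longrightarrow> f \<odot> g \<in> N"
    and unit: "\<And>f g. f \<in> N \<Longrightarrow> g \<in> Hom A a a \<Longrightarrow> f \<odot> g \<in> N \<Longrightarrow> g \<in> N"
    using N unfolding left_unitary_submonoid_def by blast+
  obtain d g \<sigma> where g: "g \<in> Hom A a d" and \<sigma>: "\<sigma> \<in> Hom A d a" and g\<sigma>: "g \<odot> \<sigma> = Ide A d"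
    and \<sigma>g: "\<sigma> \<odot> g \<in> N" and iso: "\<And>h. h \<in> N \<Longrightarrow> is_iso A (g \<odot> (h \<odot> \<sigma>))"
    using minimal_retract[OF N a] by metis
  note t = g[unfolded Hom_def] \<sigma>[unfolded Hom_def]
  have sections: "pseudo_sections A (g \<odot> h) \<subseteq> pseudo_sections A (g \<odot> h')"
    if h: "h \<in> N" and h': "h' \<in> N" for h h'
  proof
    fix i assume i: "i \<in> pseudo_sections A (g \<odot> h)"
    note tt = t sub[OF h, unfolded Hom_def] sub[OF h', unfolded Hom_def]
    have iA: "i \<in> Arr A" "Cod A i = a" and "is_iso A ((g \<odot> h) \<odot> i)"
      using i tt by (auto simp: pseudo_sections_def cat_simps)
    from this(3) obtain j where j: "j \<in> Arr A" "Dom A j = d" "Cod A j = Dom A i"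
      and ij: "(g \<odot> (h \<odot> (i \<odot> j))) = Ide A d" and jiso: "is_iso A j"
      by (rule is_isoE) (use iA tt in \<open>simp add: cat_simps\<close>)
    \<comment> \<open>As \<open>j\<close> is inverse to \<open>g h i\<close>, the pseudo-section
      \<open>i\<close> becomes a true section of \<open>g h\<close>.\<close>
    define i' where "i' = i \<odot> j"
    have i': "i' \<in> Arr A" "Dom A i' = d" "Cod A i' = a" using iA j by (simp_all add: i'_def cat_simps)
    have ghi': "g \<odot> (h \<odot> i') = Ide A d" using ij by (simp add: i'_def)
    have x: "i' \<odot> (g \<odot> h) \<in> Hom A a a" using i' tt by (simp add: Hom_def cat_simps)
    \<comment> \<open>Since \<open>g h i' = 1\<close>, the element \<open>\<sigma> g h\<close> of
      \<open>N\<close> is fixed by \<open>i' g h\<close> on the right; left unitarity then puts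
      \<open>i' g h\<close> into \<open>N\<close>.\<close>
    have "(\<sigma> \<odot> g) \<odot> (h \<odot> (i' \<odot> (g \<odot> h))) = \<sigma> \<odot> ((g \<odot> (h \<odot> i')) \<odot> (g \<odot> h))"
      using i' tt by (simp add: cat_simps)
    also have "\<dots> = (\<sigma> \<odot> g) \<odot> h" unfolding ghi' using tt by (simp add: cat_simps)
    finally have "((\<sigma> \<odot> g) \<odot> h) \<odot> (i' \<odot> (g \<odot> h)) = (\<sigma> \<odot> g) \<odot> h"
      using i' tt by (simp add: cat_simps)
    then have "i' \<odot> (g \<odot> h) \<in> N"
      using unit[OF mult[OF \<sigma>g h] x] mult[OF \<sigma>g h] by simp
    then have "is_iso A (g \<odot> ((h' \<odot> (i' \<odot> (g \<odot> h))) \<odot> \<sigma>))" using iso mult h' by blast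
    \<comment> \<open>Rebracketing isolates the invertible right factor \<open>g h \<sigma>\<close>,
      which can be cancelled.\<close>
    then have "is_iso A ((g \<odot> (h' \<odot> i')) \<odot> (g \<odot> (h \<odot> \<sigma>)))"
      using i' tt by (simp add: cat_simps)
    then have "is_iso A (g \<odot> (h' \<odot> i'))"
      by (rule is_iso_cancel_right[OF _ iso[OF h]]) (use i' tt in \<open>simp_all add: cat_simps\<close>)
    then have "is_iso A (((g \<odot> h') \<odot> i) \<odot> j)"
      unfolding i'_def using iA j tt by (simp add: cat_simps)
    then have "is_iso A ((g \<odot> h') \<odot> i)"
      by (rule is_iso_cancel_right[OF _ jiso]) (use iA j tt in \<open>simp_all add: cat_simps\<close>)
    then show "i \<in> pseudo_sections A (g \<odot> h')"
      using iA tt by (simp add: pseudo_sections_def cat_simps)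
  qed
  have epi: "is_split_epi A (g \<odot> h)" if h: "h \<in> N" for h
  proof -
    note tt = t sub[OF h, unfolded Hom_def]
    \<comment> \<open>With \<open>k\<close> inverse to \<open>g h \<sigma>\<close>, the arrow
      \<open>\<sigma> k\<close> is a section of \<open>g h\<close>.\<close>
    obtain k where "k \<in> Arr A" "Dom A k = d" "Cod A k = d" "(g \<odot> (h \<odot> \<sigma>)) \<odot> k = Ide A d"
      by (rule is_isoE[OF iso[OF h]]) (use tt in \<open>simp add: cat_simps\<close>)
    then show ?thesis
      using tt unfolding is_split_epi_def
      by (auto simp: Hom_def cat_simps intro!: exI[of _ "\<sigma> \<odot> k"])
  qed
  have gone: "g \<odot> Ide A a = g" using t by (simp add: cat_simps)
  have "g \<odot> h = g" if h: "h \<in> N" and idem: "h \<odot> h = h" for h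
  proof -
    note tt = t sub[OF h, unfolded Hom_def]
    have "pseudo_sections A (g \<odot> Ide A a) = pseudo_sections A (g \<odot> h)"
      using sections[OF one h] sections[OF h one] by blast
    moreover have "g \<odot> Ide A a \<in> Aminus" "g \<odot> h \<in> Aminus"
      using epi[OF one] epi[OF h] split_epi_in_Aminus by blast+
    ultimately have "pseudo_equal A g (g \<odot> h)"
      using minus_pseudo_equal[of g "g \<odot> h"] tt by (simp add: gone cat_simps)
    then obtain \<phi> where \<phi>: "\<phi> \<in> Hom A d d" "is_iso A \<phi>" "\<phi> \<odot> g = g \<odot> h"
      using tt by (auto simp: pseudo_equal_def cat_simps)
    obtain \<psi> where \<psi>: "\<psi> \<in> Arr A" "Dom A \<psi> = d" "Cod A \<psi> = d" "\<psi> \<odot> \<phi> = Ide A d"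
      by (rule is_isoE[OF \<phi>(2)]) (use \<phi>(1) in \<open>simp add: Hom_def\<close>)
    have cancel: "\<psi> \<odot> (\<phi> \<odot> x) = x" if "x \<in> Hom A a d" for x
      using that \<phi>(1) \<psi> Comp_assoc_right[of x \<phi> \<psi>] by (simp add: Hom_def cat_simps)
    have gh: "g \<odot> h \<in> Hom A a d" using tt by (simp add: Hom_def cat_simps)
    \<comment> \<open>Idempotence gives \<open>\<phi> g h = g h h = g h = \<phi> g\<close>, where
      \<open>\<phi>\<close> cancels.\<close>
    have "\<phi> \<odot> (g \<odot> h) = (\<phi> \<odot> g) \<odot> h" using \<phi>(1) tt by (simp add: Hom_def cat_simps)
    also have "\<dots> = g \<odot> (h \<odot> h)" using \<phi>(3) tt by (simp add: cat_simps)
    also have "\<dots> = \<phi> \<odot> g" using idem \<phi>(3) by simp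
    finally have "\<psi> \<odot> (\<phi> \<odot> (g \<odot> h)) = \<psi> \<odot> (\<phi> \<odot> g)" by simp
    then show ?thesis using cancel[OF gh] cancel[OF g] by simp
  qed
  with that[OF g \<sigma> g\<sigma> \<sigma>g] show thesis by blast
qed

lemma split_pushout_exists:
  assumes p: "p \<in> Aminus" and p': "p' \<in> Aminus" and dom: "Dom A p = Dom A p'"
  shows "\<exists>r r'. is_split_pushout A p p' r r'"
proof -
  obtain s where s: "p \<in> Arr A" "s \<in> Arr A" "Dom A s = Cod A p" "Cod A s = Dom A p"
    "p \<odot> s = Ide A (Cod A p)" using minus_split_epi[OF p] by (rule is_split_epiE)
  obtain s' where s': "p' \<in> Arr A" "s' \<in> Arr A" "Dom A s' = Cod A p'" "Cod A s' = Dom A p"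
    "p' \<odot> s' = Ide A (Cod A p')" using minus_split_epi[OF p'] dom by (metis is_split_epiE)
  define a where "a = Dom A p"
  have a: "a \<in> Obj A" using s by (simp add: a_def Dom_in_Obj)
  define N where "N = {f \<in> Hom A a a. span_equiv A p p' f (Ide A a)}"
  have N: "left_unitary_submonoid A a N"
    unfolding N_def using s s' dom by (intro left_unitary_span_equiv_Ide) (simp_all add: a_def)
  obtain d g \<sigma> where g: "g \<in> Hom A a d" and \<sigma>: "\<sigma> \<in> Hom A d a" and g\<sigma>: "g \<odot> \<sigma> = Ide A d"
    and \<sigma>g: "\<sigma> \<odot> g \<in> N" and absorb: "\<And>h. h \<in> N \<Longrightarrow> h \<odot> h = h \<Longrightarrow> g \<odot> h = g"
    using minimal_retract_absorbs_idempotents[OF N a] by metis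
  note t = s s' dom[symmetric] a_def[symmetric] a
  \<comment> \<open>Each equation is a single generating step from \<open>s p\<close> or
    \<open>s' p'\<close> to the identity, and also shows that arrow to be idempotent.\<close>
  have psp: "p \<odot> (s \<odot> p) = p" "p' \<odot> (s' \<odot> p') = p'"
    using t Comp_assoc_right[of p s p] Comp_assoc_right[of p' s' p'] by (simp_all add: cat_simps)
  have "span_equiv A p p' (s \<odot> p) (Ide A a)"
    by (rule span_equiv.left[of _ _ a]) (use t psp in \<open>simp_all add: Hom_def cat_simps\<close>)
  moreover have "span_equiv A p p' (s' \<odot> p') (Ide A a)"
    by (rule span_equiv.right[of _ _ a]) (use t psp in \<open>simp_all add: Hom_def cat_simps\<close>)
  ultimately have "s \<odot> p \<in> N" "s' \<odot> p' \<in> N"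
    using t by (simp_all add: N_def Hom_def cat_simps)
  moreover have "(s \<odot> p) \<odot> (s \<odot> p) = s \<odot> p" "(s' \<odot> p') \<odot> (s' \<odot> p') = s' \<odot> p'"
    using t psp by (simp_all add: cat_simps)
  ultimately have "g \<odot> (s \<odot> p) = g" "g \<odot> (s' \<odot> p') = g" using absorb by blast+
  then have r: "(g \<odot> s) \<odot> p = g" "(g \<odot> s') \<odot> p' = g"
    using g t by (simp_all add: Hom_def cat_simps)
  \<comment> \<open>The diagonal of the square is \<open>g\<close>; membership of
    \<open>\<sigma> g\<close> in \<open>N\<close> is the required zigzag.\<close>
  have "is_split_pushout A p p' (g \<odot> s) (g \<odot> s')"
    unfolding is_split_pushout_def commuting_cocone_def r
    using g \<sigma> g\<sigma> \<sigma>g t minus_split_epi p p'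
    by (auto simp: Hom_def N_def cat_simps)
  then show ?thesis by blast
qed

end

theorem theorem6p6:
  fixes A :: "('o, 'm) cat" and Aminus Aplus :: "'m set" and deg :: "'o \<Rightarrow> nat"
  assumes "strongly_skeletal_reedy_category A Aminus Aplus deg"
  shows "eilenberg_zilber_category TYPE(('x, 'y) cat) A Aminus Aplus deg"
proof -
  interpret strongly_skeletal_reedy_category A Aminus Aplus deg by fact
  show ?thesis
  proof
    fix p p' assume "p \<in> Aminus" "p' \<in> Aminus" "Dom A p = Dom A p'"
    then show "\<exists>r r'. is_absolute_pushout TYPE(('x, 'y) cat) A p p' r r'"
      using split_pushout_exists split_pushout_is_absolute by blast
  qed
qed

end
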